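(* Let $\phi_0,\phi_1,\dots,\phi_N\in B_1$ be fractal interpolation functions satisfying $\phi_i(x_j)=\delta_{ij}$ for all $i,j\in\{0,1,\dots,N\}$, where $\delta_{ij}$ is the Kronecker delta. Then $\phi_0,\phi_1,\dots,\phi_N$ are linearly independent over $\mathbb{R}$.
   Context: Let $[a,b]$ be a closed interval with $a<b$, let $N\ge 2$ be an integer, and let $a=x_0<x_1<\cdots<x_N=b$ be a partition. For $l=0,\dots,N-1$ let $u_l(x)=a_lx+b_l$ be the affine map with $u_l(x_0)=x_l$ and $u_l(x_N)=x_{l+1}$. Fix real numbers $s_0,\dots,s_{N-1}$ with $|s_l|<1$ for every $l$. Let $P_1$ be the space of real polynomials of degree at most $1$. For $\lambda=(\lambda_0,\dots,\lambda_{N-1})\in\prod_{l=0}^{N-1}P_1$, the fractal function $f_\lambda$ is the unique bounded function $f_\lambda:[a,b)\to\mathbb{R}$ with $f_\lambda(x)=s_l\,f_\lambda(u_l^{-1}(x))+\lambda_l(u_l^{-1}(x))$ for all $x\in[x_l,x_{l+1})$ and all $l=0,\dots,N-1$; it is extended to $[a,b]$ by setting $f_\lambda(b)=\lim_{x\to b^-}f_\lambda(x)$. The space $B_1$ is the set of all these functions $f_\lambda:[a,b]\to\mathbb{R}$ with $\lambda\in\prod_{l=0}^{N-1}P_1$. A fractal interpolation function in $B_1$ is an element of $B_1$ which is continuous on $[a,b]$ and takes prescribed values at the points $x_0,\dots,x_N$. *)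

theory Defs
  imports "HOL-Analysis.Analysis" "HOL-Computational_Algebra.Polynomial"
begin

(* Functions on [x 0, x N] are modelled by functions real => real; their values outside
   this interval are left unconstrained and never used. *)

definition fractal_function ::
  "nat \<Rightarrow> (nat \<Rightarrow> real) \<Rightarrow> (nat \<Rightarrow> real \<Rightarrow> real) \<Rightarrow> (nat \<Rightarrow> real) \<Rightarrow> (nat \<Rightarrow> real poly)
    \<Rightarrow> (real \<Rightarrow> real) \<Rightarrow> bool" where
  "fractal_function N x u s p f \<longleftrightarrow>
     bounded (f ` {x 0..<x N}) \<and>
     (\<forall>l<N. \<forall>t\<in>{x l..<x (Suc l)}. f t = s l * f (inv (u l) t) + poly (p l) (inv (u l) t)) \<and>
     (f \<longlongrightarrow> f (x N)) (at_left (x N))"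

definition B1 ::
  "nat \<Rightarrow> (nat \<Rightarrow> real) \<Rightarrow> (nat \<Rightarrow> real \<Rightarrow> real) \<Rightarrow> (nat \<Rightarrow> real) \<Rightarrow> (real \<Rightarrow> real) set" where
  "B1 N x u s = {f. \<exists>p. (\<forall>l<N. degree (p l) \<le> 1) \<and> fractal_function N x u s p f}"

definition fractal_interpolation_function ::
  "nat \<Rightarrow> (nat \<Rightarrow> real) \<Rightarrow> (nat \<Rightarrow> real \<Rightarrow> real) \<Rightarrow> (nat \<Rightarrow> real) \<Rightarrow> (nat \<Rightarrow> real)
    \<Rightarrow> (real \<Rightarrow> real) \<Rightarrow> bool" where
  "fractal_interpolation_function N x u s y f \<longleftrightarrow>
     f \<in> B1 N x u s \<and> continuous_on {x 0..x N} f \<and> (\<forall>j\<le>N. f (x j) = y j)"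

(* Linear independence of an indexed family of functions on a common domain D; the library's
   "independent" is about sets of vectors of a type, here the vectors are functions on D. *)
definition linearly_independent_on ::
  "real set \<Rightarrow> 'i set \<Rightarrow> ('i \<Rightarrow> real \<Rightarrow> real) \<Rightarrow> bool" where
  "linearly_independent_on D I \<phi> \<longleftrightarrow>
     (\<forall>J c. finite J \<and> J \<subseteq> I \<and> (\<forall>t\<in>D. (\<Sum>i\<in>J. c i * \<phi> i t) = 0) \<longrightarrow> (\<forall>i\<in>J. c i = 0))"

(* The parameters p determine the fractal function on the whole interval. *)
lemma fractal_function_unique:
  fixes x s \<alpha> \<beta> :: "nat \<Rightarrow> real" and u :: "nat \<Rightarrow> real \<Rightarrow> real"
  assumes N: "0 < N"
    and x: "\<And>l. l < N \<Longrightarrow> x l < x (Suc l)"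
    and u: "\<And>l t. l < N \<Longrightarrow> u l t = \<alpha> l * t + \<beta> l"
    and u0: "\<And>l. l < N \<Longrightarrow> u l (x 0) = x l"
    and uN: "\<And>l. l < N \<Longrightarrow> u l (x N) = x (Suc l)"
    and s: "\<And>l. l < N \<Longrightarrow> \<bar>s l\<bar> < 1"
    and f: "fractal_function N x u s p f" and g: "fractal_function N x u s p g"
    and t: "t \<in> {x 0..x N}"
  shows "f t = g t"
proof -
  define d where "d = (\<lambda>t. f t - g t)"
  define I where "I = {x 0..<x N}"
  have "x 0 < x n" if "0 < n" "n \<le> N" for n
    using that
  proof (induction n)
    case (Suc n)
    then show ?case using x[of n] by (cases "n = 0") auto
  qed simp
  then have x0N: "x 0 < x N" using N by simp
  have piece: "\<exists>l<N. r \<in> {x l..<x (Suc l)}" if "r \<in> I" for r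
  proof -
    have "r < x n \<Longrightarrow> \<exists>l<n. r \<in> {x l..<x (Suc l)}" for n
    proof (induction n)
      case 0
      then show ?case using that by (auto simp: I_def)
    next
      case (Suc n)
      then show ?case by (cases "r < x n") (use less_Suc_eq in auto)
    qed
    then show ?thesis using that by (auto simp: I_def)
  qed
  have pull: "inv (u l) r \<in> I" if l: "l < N" and r: "r \<in> {x l..<x (Suc l)}" for l r
  proof -
    have e: "\<alpha> l * x 0 + \<beta> l = x l" "\<alpha> l * x N + \<beta> l = x (Suc l)"
      using u[OF l] u0[OF l] uN[OF l] by auto
    have "\<alpha> l * (x N - x 0) > 0" using e x[OF l] by (simp add: algebra_simps)
    then have pos: "\<alpha> l > 0" using x0N by (simp add: zero_less_mult_iff)
    define q where "q = (r - \<beta> l) / \<alpha> l"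
    have uq: "u l q = r" using pos u[OF l] by (simp add: q_def)
    have "inj (u l)" using pos u[OF l] by (auto simp: inj_on_def)
    then have "inv (u l) r = q" using uq inv_f_f by metis
    moreover have "x 0 \<le> q" "q < x N"
      using r e pos by (auto simp: q_def field_simps)
    ultimately show ?thesis by (simp add: I_def)
  qed
  have bd: "bounded (d ` I)"
    using bounded_minus_comp[of f I g] f g unfolding fractal_function_def d_def I_def by blast
  define M where "M = (SUP r\<in>I. \<bar>d r\<bar>)"
  have bdd: "bdd_above ((\<lambda>r. \<bar>d r\<bar>) ` I)"
    using bd by (auto simp: bounded_iff bdd_above_def)
  have ne: "x 0 \<in> I" using x0N by (simp add: I_def)
  have le: "\<bar>d r\<bar> \<le> M" if "r \<in> I" for r
    unfolding M_def by (rule cSUP_upper[OF that bdd])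
  have M0: "0 \<le> M" using le[OF ne] by linarith
  define c where "c = Max ((\<lambda>l. \<bar>s l\<bar>) ` {..<N})"
  have c: "c < 1" "\<And>l. l < N \<Longrightarrow> \<bar>s l\<bar> \<le> c"
    using s N unfolding c_def by (auto simp: lessThan_empty_iff)
  have "\<bar>d r\<bar> \<le> c * M" if r: "r \<in> I" for r
  proof -
    obtain l where l: "l < N" "r \<in> {x l..<x (Suc l)}" using piece[OF r] by blast
    have "d r = s l * d (inv (u l) r)"
      using f g l unfolding fractal_function_def d_def by (simp add: algebra_simps)
    then have "\<bar>d r\<bar> = \<bar>s l\<bar> * \<bar>d (inv (u l) r)\<bar>" by (simp add: abs_mult)
    also have "\<dots> \<le> c * M"
      using c(2)[OF l(1)] le[OF pull[OF l]] by (intro mult_mono) auto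
    finally show ?thesis .
  qed
  then have "M \<le> c * M" unfolding M_def using ne by (intro cSUP_least) auto
  then have "(1 - c) * M \<le> 0" by (simp add: algebra_simps)
  then have "M \<le> 0" using c(1) by (simp add: mult_le_0_iff)
  then have I: "f r = g r" if "r \<in> I" for r using le[OF that] by (simp add: d_def)
  have "eventually (\<lambda>r. r \<in> {x 0<..<x N}) (at_left (x N))"
    using x0N by (rule eventually_at_left_real)
  then have "eventually (\<lambda>r. f r = g r) (at_left (x N))"
    by (rule eventually_mono) (auto simp: I_def intro: I)
  then have "(g \<longlongrightarrow> f (x N)) (at_left (x N))"
    using f tendsto_cong unfolding fractal_function_def by blast
  then have "f (x N) = g (x N)"
    using g tendsto_unique[OF trivial_limit_at_left_real] unfolding fractal_function_def by blast
  then show ?thesis using I t by (cases "t = x N") (auto simp: I_def)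
qed

end

theory Submission imports Defs begin

text \<open>Evaluation at the partition points separates the functions: on a linear combination that
  vanishes throughout the interval, evaluation at \<open>x j\<close> returns the \<open>j\<close>-th coefficient, which is
  therefore zero.\<close>

text \<open>The evaluations at the nodes are linear functionals biorthogonal to the functions, so each
  one isolates a single coefficient of a vanishing combination.\<close>
lemma linearly_independent_on_if_Kronecker_delta:
  assumes nodes: "\<And>i. i \<in> I \<Longrightarrow> y i \<in> D"
    and delta: "\<And>i j. i \<in> I \<Longrightarrow> j \<in> I \<Longrightarrow> \<phi> i (y j) = (if i = j then 1 else 0)"
  shows "linearly_independent_on D I \<phi>"
  unfolding linearly_independent_on_def
proof (intro allI impI ballI, elim conjE)
  fix J c j
  assume J: "finite J" "J \<subseteq> I" "\<forall>t\<in>D. (\<Sum>i\<in>J. c i * \<phi> i t) = 0" and j: "j \<in> J"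
  have "(\<Sum>i\<in>J. c i * \<phi> i (y j)) = (\<Sum>i\<in>J. if i = j then c i else 0)"
    using J(2) j by (intro sum.cong) (auto simp: delta subset_iff)
  also have "\<dots> = c j"
    using J(1) j by simp
  finally show "c j = 0"
    using J nodes j by auto
qed

lemma partition_point_mono:
  fixes x :: "nat \<Rightarrow> real"
  assumes step: "\<And>l. l < N \<Longrightarrow> x l < x (Suc l)" and "i \<le> j" "j \<le> N"
  shows "x i \<le> x j"
  using assms(2,3)
proof (induction j rule: dec_induct)
  case (step n)
  then show ?case using assms(1)[of n] by simp
qed simp

theorem theorem2:
  fixes a b :: real and N :: nat and x s \<alpha> \<beta> :: "nat \<Rightarrow> real"
    and u :: "nat \<Rightarrow> real \<Rightarrow> real" and \<phi> :: "nat \<Rightarrow> real \<Rightarrow> real"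
  assumes "a < b" and "2 \<le> N"
    and "x 0 = a" and "x N = b" and "\<And>l. l < N \<Longrightarrow> x l < x (Suc l)"
    and "\<And>l t. l < N \<Longrightarrow> u l t = \<alpha> l * t + \<beta> l"
    and "\<And>l. l < N \<Longrightarrow> u l (x 0) = x l" and "\<And>l. l < N \<Longrightarrow> u l (x N) = x (Suc l)"
    and "\<And>l. l < N \<Longrightarrow> \<bar>s l\<bar> < 1"
    and "\<And>i. i \<le> N \<Longrightarrow>
           fractal_interpolation_function N x u s (\<lambda>j. if i = j then 1 else 0) (\<phi> i)"
  shows "linearly_independent_on {a..b} {0..N} \<phi>"
proof (rule linearly_independent_on_if_Kronecker_delta[where y = x])
  fix i assume "i \<in> {0..N}"
  then show "x i \<in> {a..b}"
    using partition_point_mono[of N x 0 i] partition_point_mono[of N x i N] assms(3-5) by simp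
next
  fix i j assume "i \<in> {0..N}" "j \<in> {0..N}"
  then show "\<phi> i (x j) = (if i = j then 1 else 0)"
    using assms(10)[of i] unfolding fractal_interpolation_function_def by simp
qed

end
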